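(* Let $m>2$ and $n\geq 1$ be integers, and let $\mathbb{P}_m(n)$ be the undirected prefix-reversal graph. Then every even integer in the set $[0,2n]\setminus\{2\lfloor n/2\rfloor\}$ belongs to the spectrum of $\mathbb{P}_m(n)$. Moreover, if $m\equiv 0\pmod 4$, then every even integer in $[0,2n]$ belongs to the spectrum of $\mathbb{P}_m(n)$.
   Context: For integers $a<b$, $[a,b]=\{a,a+1,\ldots,b\}$, and $[n]=\{1,\ldots,n\}$. Let $C_m=\{0,1,\ldots,m-1\}$ be the cyclic group of order $m$, written additively, and let $S(m,n)=C_m\wr S_n$ be the group of colored permutations. An element of $S(m,n)$ is written $\pi=\pi_1^{e_1}\pi_2^{e_2}\cdots\pi_n^{e_n}$, where $\pi_1\pi_2\cdots\pi_n$ is a permutation of $[n]$ in one-line notation and $e_1,\ldots,e_n\in C_m$ are the colors attached to the symbols. For $i\in[n]$, the $i$-th flip $r_i^+$ and the $i$-th flop $r_i^-$ act by $$r_i^{+}(\pi_1^{e_1}\cdots\pi_n^{e_n})=\pi_i^{e_i+1}\pi_{i-1}^{e_{i-1}+1}\cdots\pi_1^{e_1+1}\pi_{i+1}^{e_{i+1}}\cdots\pi_n^{e_n},$$ $$r_i^{-}(\pi_1^{e_1}\cdots\pi_n^{e_n})=\pi_i^{e_i-1}\pi_{i-1}^{e_{i-1}-1}\cdots\pi_1^{e_1-1}\pi_{i+1}^{e_{i+1}}\cdots\pi_n^{e_n},$$ with colors taken mod $m$. Let $R_n^{\pm}=\{r_i^+,r_i^-: i\in[n]\}$. The undirected prefix-reversal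 graph $\mathbb{P}_m(n)$ has vertex set $S(m,n)$ and edge set $\{(v,r(v)): v\in S(m,n),\ r\in R_n^{\pm}\}$; since $R_n^\pm$ is closed under inverses, it may be regarded as an undirected graph (a Cayley graph of $S(m,n)$). The spectrum of a graph is the set of eigenvalues (with multiplicities) of its adjacency matrix. *)

theory Defs
  imports
    "HOL-Combinatorics.Multiset_Permutations"
    "HOL-Number_Theory.Cong"
    "Graph_Theory.Pair_Digraph"
    "Jordan_Normal_Form.Spectral_Radius"
begin

section \<open>Colored permutations\<close>

text \<open>
  The colored permutation written $\pi_1^{e_1} \cdots \pi_n^{e_n}$ is represented by the list
  \<open>[(\<pi>\<^sub>1, e\<^sub>1), \<dots>, (\<pi>\<^sub>n, e\<^sub>n)]\<close> of its symbols in one-line notation, each paired with its color.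
  Colors are the canonical representatives \<open>0, \<dots>, m - 1\<close> of the integers modulo \<open>m\<close>.
\<close>

type_synonym colored_word = "(nat \<times> int) list"

definition colored_perms :: "nat \<Rightarrow> nat \<Rightarrow> colored_word set" where
  "colored_perms m n =
     {w. map fst w \<in> permutations_of_set {1..n} \<and> snd ` set w \<subseteq> {0..<int m}}"

definition shift_color :: "nat \<Rightarrow> int \<Rightarrow> nat \<times> int \<Rightarrow> nat \<times> int" where
  "shift_color m d x = (fst x, (snd x + d) mod int m)"

definition flip :: "nat \<Rightarrow> nat \<Rightarrow> colored_word \<Rightarrow> colored_word" where
  "flip m i w = rev (map (shift_color m 1) (take i w)) @ drop i w"

definition flop :: "nat \<Rightarrow> nat \<Rightarrow> colored_word \<Rightarrow> colored_word" where
  "flop m i w = rev (map (shift_color m (- 1)) (take i w)) @ drop i w"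

definition prefix_reversals :: "nat \<Rightarrow> nat \<Rightarrow> (colored_word \<Rightarrow> colored_word) set" where
  "prefix_reversals m n = flip m ` {1..n} \<union> flop m ` {1..n}"


section \<open>The undirected prefix-reversal graph\<close>

text \<open>
  An undirected graph is a digraph whose arc set is symmetric. The arcs form a set of ordered
  pairs, so there are no parallel arcs; \<open>pair_graph_prefix_reversal_graph\<close> below shows that
  for \<open>m > 2\<close> this is a finite simple undirected graph.
\<close>

definition prefix_reversal_graph :: "nat \<Rightarrow> nat \<Rightarrow> colored_word pair_pre_digraph" where
  "prefix_reversal_graph m n =
     \<lparr> pverts = colored_perms m n,
       parcs = {(v, r v) | v r. v \<in> colored_perms m n \<and> r \<in> prefix_reversals m n} \<rparr>"


section \<open>Adjacency matrices and graph spectra\<close>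

definition adjacency_matrix :: "'a pair_pre_digraph \<Rightarrow> 'a list \<Rightarrow> real mat" where
  "adjacency_matrix G vs =
     mat (length vs) (length vs) (\<lambda>(i, j). if (vs ! i, vs ! j) \<in> parcs G then 1 else 0)"

text \<open>
  The rows and columns of the matrix have to be listed in some order. The order is immaterial, see
  \<open>graph_spectrum_eq\<close> below. The graph is meant to be finite, as otherwise no listing
  of the vertices exists.
\<close>

definition graph_spectrum :: "'a pair_pre_digraph \<Rightarrow> real set" where
  "graph_spectrum G =
     spectrum (adjacency_matrix G (SOME vs. distinct vs \<and> set vs = pverts G))"

lemma sum_nth_distinct:
  assumes "distinct vs"
  shows "(\<Sum>j<length vs. h (vs ! j)) = sum h (set vs)"
  using sum.reindex_bij_betw[OF bij_betw_nth[OF assms refl refl], of h] by simp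

lemma adjacency_matrix_mult_vec:
  assumes "distinct vs" "i < length vs" "x \<in> carrier_vec (length vs)"
    and "\<And>j. j < length vs \<Longrightarrow> x $ j = f (vs ! j)"
  shows "(adjacency_matrix G vs *\<^sub>v x) $ i = (\<Sum>w | w \<in> set vs \<and> (vs ! i, w) \<in> parcs G. f w)"
proof -
  have "(adjacency_matrix G vs *\<^sub>v x) $ i =
      (\<Sum>j<length vs. (if (vs ! i, vs ! j) \<in> parcs G then f (vs ! j) else 0))"
    using assms by (auto simp: adjacency_matrix_def scalar_prod_def lessThan_atLeast0 intro!: sum.cong)
  also have "\<dots> = (\<Sum>w\<in>set vs. (if (vs ! i, w) \<in> parcs G then f w else 0))"
    by (rule sum_nth_distinct[OF assms(1)])
  also have "\<dots> = (\<Sum>w | w \<in> set vs \<and> (vs ! i, w) \<in> parcs G. f w)"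
    by (simp add: sum.inter_filter)
  finally show ?thesis .
qed

lemma spectrum_adjacency_matrix_iff:
  assumes "distinct vs" "set vs = pverts G"
  shows "k \<in> spectrum (adjacency_matrix G vs) \<longleftrightarrow>
    (\<exists>f. (\<exists>v\<in>pverts G. f v \<noteq> 0) \<and>
      (\<forall>v\<in>pverts G. (\<Sum>w | w \<in> pverts G \<and> (v, w) \<in> parcs G. f w) = k * f v))"
    (is "?L \<longleftrightarrow> ?R")
proof
  assume ?L
  then obtain x where x: "x \<in> carrier_vec (length vs)" "x \<noteq> 0\<^sub>v (length vs)"
      "adjacency_matrix G vs *\<^sub>v x = k \<cdot>\<^sub>v x"
    by (auto simp: spectrum_def eigenvalue_def eigenvector_def adjacency_matrix_def)
  define f where "f v = x $ (THE i. i < length vs \<and> vs ! i = v)" for v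
  have f: "f (vs ! i) = x $ i" if "i < length vs" for i
  proof -
    have "(THE j. j < length vs \<and> vs ! j = vs ! i) = i"
      using assms that by (intro the_equality) (auto simp: nth_eq_iff_index_eq)
    then show ?thesis by (simp add: f_def)
  qed
  obtain i where i: "i < length vs" "x $ i \<noteq> 0"
    using x by (metis carrier_vecD eq_vecI index_zero_vec)
  have "f (vs ! i) \<noteq> 0" "vs ! i \<in> pverts G"
    using i f assms(2) by (auto simp flip: assms(2))
  moreover have "(\<Sum>w | w \<in> pverts G \<and> (v, w) \<in> parcs G. f w) = k * f v" if "v \<in> pverts G" for v
  proof -
    have "v \<in> set vs" using that assms(2) by simp
    then obtain j where j: "j < length vs" "v = vs ! j"
      unfolding in_set_conv_nth by blast
    have "(\<Sum>w | w \<in> set vs \<and> (vs ! j, w) \<in> parcs G. f w) = (adjacency_matrix G vs *\<^sub>v x) $ j"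
      using adjacency_matrix_mult_vec[OF assms(1) j(1) x(1), of f G] f by simp
    also have "\<dots> = k * f (vs ! j)"
      using x f[OF j(1)] j(1) by simp
    finally show ?thesis using j assms by simp
  qed
  ultimately show ?R by blast
next
  assume ?R
  then obtain f v0 where f: "v0 \<in> pverts G" "f v0 \<noteq> 0"
      "\<And>v. v \<in> pverts G \<Longrightarrow> (\<Sum>w | w \<in> pverts G \<and> (v, w) \<in> parcs G. f w) = k * f v"
    by blast
  define x where "x = vec (length vs) (\<lambda>i. f (vs ! i))"
  have x: "x \<in> carrier_vec (length vs)" "\<And>j. j < length vs \<Longrightarrow> x $ j = f (vs ! j)"
    by (auto simp: x_def)
  have "v0 \<in> set vs" using f(1) assms(2) by simp
  then obtain i where i: "i < length vs" "v0 = vs ! i"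
    unfolding in_set_conv_nth by blast
  have "x \<noteq> 0\<^sub>v (length vs)"
    using i f(2) x(2)[OF i(1)] by auto
  moreover have "adjacency_matrix G vs *\<^sub>v x = k \<cdot>\<^sub>v x"
  proof (rule eq_vecI)
    show "dim_vec (adjacency_matrix G vs *\<^sub>v x) = dim_vec (k \<cdot>\<^sub>v x)"
      by (simp add: adjacency_matrix_def x_def)
  next
    fix j assume "j < dim_vec (k \<cdot>\<^sub>v x)"
    then have j: "j < length vs" by (simp add: x_def)
    then have "vs ! j \<in> pverts G" using nth_mem[of j vs] assms(2) by simp
    then show "(adjacency_matrix G vs *\<^sub>v x) $ j = (k \<cdot>\<^sub>v x) $ j"
      using adjacency_matrix_mult_vec[OF assms(1) j x, of G] f(3) x(2)[OF j] x(1) j assms(2) by simp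
  qed
  ultimately show ?L
    using x(1) by (auto simp: spectrum_def eigenvalue_def eigenvector_def adjacency_matrix_def)
qed

lemma graph_spectrum_eq:
  assumes "distinct vs" "set vs = pverts G"
  shows "graph_spectrum G = spectrum (adjacency_matrix G vs)"
proof -
  define ws where "ws = (SOME vs. distinct vs \<and> set vs = pverts G)"
  have "distinct ws \<and> set ws = pverts G"
    unfolding ws_def by (rule someI[of _ vs]) (use assms in simp)
  then show ?thesis
    using assms spectrum_adjacency_matrix_iff[of ws G] spectrum_adjacency_matrix_iff[of vs G]
    by (auto simp: graph_spectrum_def simp flip: ws_def)
qed


section \<open>Basic properties of the prefix-reversal graph\<close>

lemma finite_colored_perms: "finite (colored_perms m n)"
proof (rule finite_subset)
  show "colored_perms m n \<subseteq> {w. set w \<subseteq> {1..n} \<times> {0..<int m} \<and> length w = n}"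
    (is "_ \<subseteq> ?B")
  proof
    fix w assume w: "w \<in> colored_perms m n"
    then have "fst ` set w = {1..n}"
      by (auto simp: colored_perms_def permutations_of_set_def)
    moreover have "length (map fst w) = n"
      using w length_finite_permutations_of_set[of "map fst w" "{1..n}"]
      by (simp add: colored_perms_def)
    moreover have "snd ` set w \<subseteq> {0..<int m}"
      using w by (simp add: colored_perms_def)
    ultimately show "w \<in> ?B"
      using subset_fst_snd[of "set w"] by auto
  qed
  show "finite ?B" by (intro finite_lists_length_eq) simp
qed

lemma map_fst_shift_color: "map fst (map (shift_color m d) w) = map fst w"
  by (simp add: shift_color_def)

lemma prefix_shift_in_colored_perms:
  assumes "w \<in> colored_perms m n" "m > 0"
  shows "rev (map (shift_color m d) (take i w)) @ drop i w \<in> colored_perms m n"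
proof -
  have p: "set (map fst w) = {1..n}" "distinct (map fst w)"
    and c: "snd ` set w \<subseteq> {0..<int m}"
    using assms by (auto simp: colored_perms_def permutations_of_set_def)
  have eq: "map fst (rev (map (shift_color m d) (take i w)) @ drop i w) =
      rev (take i (map fst w)) @ drop i (map fst w)"
    by (simp add: rev_map map_fst_shift_color take_map drop_map del: map_map)
  have "mset (rev (take i (map fst w)) @ drop i (map fst w)) = mset (map fst w)"
    by (metis append_take_drop_id mset_append mset_rev)
  then have 1: "rev (take i (map fst w)) @ drop i (map fst w) \<in> permutations_of_set {1..n}"
    using p by (metis mset_eq_imp_distinct_iff mset_eq_setD permutations_of_setI)
  have 2: "snd ` set (rev (map (shift_color m d) (take i w)) @ drop i w) \<subseteq> {0..<int m}"
    using c set_drop_subset[of i w] assms(2) by (auto simp: shift_color_def image_subset_iff)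
  show ?thesis using 1 2 unfolding colored_perms_def by (simp only: eq mem_Collect_eq simp_thms)
qed

lemma prefix_shift_inverse:
  assumes "snd ` set w \<subseteq> {0..<int m}" "i \<le> length w"
    and "w' = rev (map (shift_color m d) (take i w)) @ drop i w"
  shows "rev (map (shift_color m (- d)) (take i w')) @ drop i w' = w"
proof -
  have "shift_color m (- d) (shift_color m d x) = x" if "x \<in> set (take i w)" for x
  proof -
    have "snd x \<in> {0..<int m}" using that assms(1) set_take_subset[of i w] by blast
    then show ?thesis by (simp add: shift_color_def mod_diff_left_eq prod_eq_iff)
  qed
  then have "map (shift_color m (- d) \<circ> shift_color m d) (take i w) = take i w"
    by (intro map_idI) auto
  then show ?thesis using assms(2,3) by (simp add: rev_map)
qed

lemma length_colored_perms: "w \<in> colored_perms m n \<Longrightarrow> length w = n"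
  using length_finite_permutations_of_set[of "map fst w" "{1..n}"]
  by (simp add: colored_perms_def)

lemma flop_flip:
  assumes "w \<in> colored_perms m n" "i \<in> {1..n}"
  shows "flop m i (flip m i w) = w"
  using prefix_shift_inverse[of w m i "flip m i w" 1] assms length_colored_perms[OF assms(1)]
  by (auto simp: flip_def flop_def colored_perms_def)

lemma flip_flop:
  assumes "w \<in> colored_perms m n" "i \<in> {1..n}"
  shows "flip m i (flop m i w) = w"
  using prefix_shift_inverse[of w m i "flop m i w" "- 1"] assms length_colored_perms[OF assms(1)]
  by (auto simp: flip_def flop_def colored_perms_def)

lemma prefix_shift_neq:
  assumes "w \<in> colored_perms m n" "i \<in> {1..n}" "\<not> int m dvd d"
  shows "rev (map (shift_color m d) (take i w)) @ drop i w \<noteq> w"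
proof
  assume eq: "rev (map (shift_color m d) (take i w)) @ drop i w = w"
  have len: "length w = n" using assms(1) by (rule length_colored_perms)
  have d: "distinct (map fst w)"
    using assms(1) by (auto simp: colored_perms_def permutations_of_set_def)
  obtain a c where ac: "w ! 0 = (a, c)" by fastforce
  have n0: "0 < n" using assms(2) by auto
  have mem: "(a, c) \<in> set (take i w)"
    using ac n0 assms(2) len by (auto simp: in_set_conv_nth intro!: exI[of _ 0])
  then have "shift_color m d (a, c) \<in> set (rev (map (shift_color m d) (take i w)) @ drop i w)"
    by auto
  then have "(a, (c + d) mod int m) \<in> set w" by (simp add: eq shift_color_def)
  moreover have "(a, c) \<in> set w" using mem set_take_subset[of i w] by blast
  ultimately have "(c + d) mod int m = c" using d by (meson distinct_map eq_key_imp_eq_value)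
  moreover have "c mod int m = c"
    using assms(1) \<open>(a, c) \<in> set w\<close> by (force simp: colored_perms_def)
  ultimately have "(c + d) mod int m = c mod int m" by simp
  then have "int m dvd d" by (metis add_diff_cancel_left' mod_eq_dvd_iff)
  with assms(3) show False by simp
qed

lemma flip_flop_in_colored_perms:
  assumes "w \<in> colored_perms m n" "m > 0"
  shows "flip m i w \<in> colored_perms m n" "flop m i w \<in> colored_perms m n"
  using prefix_shift_in_colored_perms[OF assms] by (auto simp: flip_def flop_def)

lemma pair_graph_prefix_reversal_graph:
  assumes "m > 2"
  shows "pair_graph (prefix_reversal_graph m n)"
proof -
  let ?G = "prefix_reversal_graph m n"
  have m0: "m > 0" using assms by simp
  have sub: "parcs ?G \<subseteq> pverts ?G \<times> pverts ?G"
    using flip_flop_in_colored_perms[OF _ m0]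
    by (auto simp: prefix_reversal_graph_def prefix_reversals_def)
  have fin: "finite (pverts ?G)"
    by (simp add: prefix_reversal_graph_def finite_colored_perms)
  have sym: "sym (parcs ?G)"
  proof (rule symI)
    fix u v assume "(u, v) \<in> parcs ?G"
    then obtain i where u: "u \<in> colored_perms m n" and i: "i \<in> {1..n}"
      and v: "v = flip m i u \<or> v = flop m i u"
      by (auto simp: prefix_reversal_graph_def prefix_reversals_def)
    have "flip m i \<in> prefix_reversals m n" "flop m i \<in> prefix_reversals m n"
      using i by (auto simp: prefix_reversals_def)
    then have "\<exists>r\<in>prefix_reversals m n. u = r v"
      using v flop_flip[OF u i] flip_flop[OF u i] by metis
    moreover have "v \<in> colored_perms m n" using v flip_flop_in_colored_perms[OF u m0] by auto
    ultimately show "(v, u) \<in> parcs ?G"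
      by (auto simp: prefix_reversal_graph_def)
  qed
  have nd: "\<not> int m dvd 1" "\<not> int m dvd - 1" using assms by auto
  have loop: "u \<noteq> v" if "(u, v) \<in> parcs ?G" for u v
    using that prefix_shift_neq[OF _ _ nd(1)] prefix_shift_neq[OF _ _ nd(2)]
    by (force simp: prefix_reversal_graph_def prefix_reversals_def flip_def flop_def)
  show ?thesis
  proof (unfold_locales; (unfold symmetric_def with_proj_simps)?)
    show "finite (parcs ?G)" using finite_subset[OF sub] fin by simp
  qed (use sub fin sym loop in auto)
qed

end

theory Submission
  imports Defs
begin

text \<open>
  A function on colored permutations that only looks at the position \<open>p\<close> (counted from \<open>0\<close>) and
  the color \<open>c\<close> of one fixed symbol, say \<open>1\<close>, is sent to a function of the same kind by the
  adjacency operator: the reversals of length at most \<open>p\<close> do not touch the symbol, while the two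
  reversals of length \<open>i > p\<close> move it to position \<open>i - 1 - p\<close> and change its color by \<open>1\<close> and
  \<open>- 1\<close>. Hence if \<open>\<chi>\<close> satisfies \<open>\<chi> (c + 1) + \<chi> (c - 1) = l * \<chi> c\<close>, then
  \<open>g p * \<chi> c\<close> is an eigenfunction for the eigenvalue \<open>\<mu>\<close> as soon as
  \[ 2 p\, g(p) + l \sum_{q < n - p} g(q) = \mu\, g(p) \qquad (p < n). \]
  This is \<open>prefix_reversal_graph_eigenvalueI\<close>. Two choices of \<open>\<chi>\<close> suffice.

  For \<open>\<chi> = 1\<close> we have \<open>l = 2\<close>, and for every \<open>k \<le> n\<close> the system with \<open>\<mu> = 2 k\<close> is solved by the
  explicit function \<open>position_weight n k\<close>, which vanishes identically only when
  \<open>k\<close> is \<open>n div 2\<close>. For \<open>4 dvd m\<close> there is a character of order four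
  with \<open>l = 0\<close>. It makes the system diagonal with entries \<open>0, 2, \<dots>, 2 * n - 2\<close>, and this
  supplies the missing eigenvalue.
\<close>

section \<open>The neighbors of a colored permutation\<close>

lemma fst_shift_color [simp]: "fst (shift_color m d x) = fst x"
  by (simp add: shift_color_def)

definition prefix_shift :: "nat \<Rightarrow> int \<Rightarrow> nat \<Rightarrow> colored_word \<Rightarrow> colored_word" where
  "prefix_shift m d i w = rev (map (shift_color m d) (take i w)) @ drop i w"

lemma flip_eq_prefix_shift: "flip m i = prefix_shift m 1 i"
  and flop_eq_prefix_shift: "flop m i = prefix_shift m (- 1) i"
  by (auto simp: flip_def flop_def prefix_shift_def)

text \<open>
  The color of the last reversed symbol reveals the length, and then the color of the first one
  reveals the amount by which the colors were shifted.
\<close>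

lemma prefix_shift_inj:
  assumes w: "w \<in> colored_perms m n" and m: "m > 0"
    and ij: "i \<in> {1..n}" "j \<in> {1..n}"
    and d: "\<not> int m dvd d" "\<not> int m dvd d'"
    and eq: "prefix_shift m d i w = prefix_shift m d' j w"
  shows "i = j \<and> int m dvd d - d'"
proof -
  have len: "length w = n" using w by (rule length_colored_perms)
  have dist: "distinct (map fst (prefix_shift m d i w))" for d i
    using prefix_shift_in_colored_perms[OF w m, of d i]
    by (auto simp: prefix_shift_def colored_perms_def permutations_of_set_def)
  have color: "snd x mod int m = snd x" if "x \<in> set w" for x
    using w that by (auto simp: colored_perms_def image_subset_iff)
  have moved: "shift_color m d (w ! p) \<in> set (prefix_shift m d i w)"
    if "p < i" "i \<in> {1..n}" for d i p
  proof -
    have "w ! p \<in> set (take i w)"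
      using that len by (auto simp: in_set_conv_nth intro!: exI[of _ p])
    then show ?thesis by (auto simp: prefix_shift_def)
  qed
  have kept: "w ! p \<in> set (prefix_shift m d i w)" if "i \<le> p" "p < n" for d i p
  proof -
    have "w ! p \<in> set (drop i w)"
      using that len by (auto simp: in_set_conv_nth intro!: exI[of _ "p - i"])
    then show ?thesis by (auto simp: prefix_shift_def)
  qed
  have same: "snd x = snd y"
    if "x \<in> set (prefix_shift m d i w)" "y \<in> set (prefix_shift m d i w)" "fst x = fst y" for x y d i
    using dist[of d i] that by (metis distinct_map inj_onD)
  have unshifted: "int m dvd d"
    if "snd (shift_color m d (w ! p)) = snd (w ! p)" "p < n" for p d
  proof -
    have "(snd (w ! p) + d) mod int m = snd (w ! p) mod int m"
      using that color[of "w ! p"] len by (simp add: shift_color_def)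
    then show ?thesis by (metis add_diff_cancel_left' mod_eq_dvd_iff)
  qed
  have not_less: "\<not> a < b"
    if "prefix_shift m e a w = prefix_shift m e' b w" "b \<in> {1..n}" "\<not> int m dvd e'" for a b e e'
  proof
    assume "a < b"
    then have "w ! (b - 1) \<in> set (prefix_shift m e a w)"
      "shift_color m e' (w ! (b - 1)) \<in> set (prefix_shift m e a w)"
      using kept[of a "b - 1" e] moved[of "b - 1" b e'] that by auto
    then have "snd (shift_color m e' (w ! (b - 1))) = snd (w ! (b - 1))"
      by (intro same[of _ e a]) simp_all
    moreover have "b - 1 < n" using that(2) unfolding atLeastAtMost_iff by linarith
    ultimately show False using unshifted that(3) by blast
  qed
  have "i = j" using not_less[OF eq ij(2) d(2)] not_less[OF eq[symmetric] ij(1) d(1)] by simp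
  moreover have "snd (shift_color m d (w ! 0)) = snd (shift_color m d' (w ! 0))"
    by (rule same[of _ d i])
      (use moved[of 0 i d] moved[of 0 j d'] ij eq in \<open>auto simp: shift_color_def\<close>)
  then have "(snd (w ! 0) + d) mod int m = (snd (w ! 0) + d') mod int m"
    by (simp add: shift_color_def)
  then have "int m dvd d - d'" by (simp add: mod_eq_dvd_iff)
  ultimately show ?thesis by simp
qed

text \<open>
  For \<open>m > 2\<close> the \<open>2 * n\<close> reversals lead to different vertices, so that the sum over the neighbors
  is a sum over reversals. Flips and flops agree for \<open>m = 2\<close>.
\<close>

lemma sum_neighbors:
  fixes f :: "colored_word \<Rightarrow> real"
  assumes m: "m > 2" and v: "v \<in> colored_perms m n"
  shows "(\<Sum>w | w \<in> pverts (prefix_reversal_graph m n) \<and> (v, w) \<in> parcs (prefix_reversal_graph m n). f w)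
    = (\<Sum>i = 1..n. f (prefix_shift m 1 i v) + f (prefix_shift m (- 1) i v))"
proof -
  let ?N = "\<lambda>d. (\<lambda>i. prefix_shift m d i v) ` {1..n}"
  have nd: "\<not> int m dvd 1" "\<not> int m dvd - 1" "\<not> int m dvd 2"
    using m zdvd_imp_le[of "int m" 2] by auto
  have "{w. w \<in> pverts (prefix_reversal_graph m n) \<and> (v, w) \<in> parcs (prefix_reversal_graph m n)}
      = ?N 1 \<union> ?N (- 1)"
    using v m flip_flop_in_colored_perms[OF v]
    by (auto simp: prefix_reversal_graph_def prefix_reversals_def
        flip_eq_prefix_shift flop_eq_prefix_shift)
  moreover have "?N 1 \<inter> ?N (- 1) = {}"
  proof -
    have False if "prefix_shift m 1 i v = prefix_shift m (- 1) j v" "i \<in> {1..n}" "j \<in> {1..n}" for i j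
      using prefix_shift_inj[OF v _ that(2,3) nd(1,2) that(1)] nd(3) m by simp
    then show ?thesis by blast
  qed
  moreover have inj: "inj_on (\<lambda>i. prefix_shift m d i v) {1..n}" if "\<not> int m dvd d" for d
    using prefix_shift_inj[OF v _ _ _ that that] m by (auto simp: inj_on_def)
  ultimately show ?thesis
    by (simp add: sum.union_disjoint sum.reindex[OF inj[OF nd(1)]]
        sum.reindex[OF inj[OF nd(2)]] sum.distrib del: One_nat_def)
qed


section \<open>Functions of the position and color of one symbol\<close>

definition symbol_one_function :: "(nat \<Rightarrow> real) \<Rightarrow> (int \<Rightarrow> real) \<Rightarrow> colored_word \<Rightarrow> real" where
  "symbol_one_function g \<chi> w =
     (let p = length (takeWhile (\<lambda>x. fst x \<noteq> 1) w) in g p * \<chi> (snd (w ! p)))"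

lemma symbol_one_function_append:
  assumes "1 \<notin> fst ` set xs"
  shows "symbol_one_function g \<chi> (xs @ (1, c) # ys) = g (length xs) * \<chi> c"
proof -
  have "takeWhile (\<lambda>x. fst x \<noteq> 1) (xs @ (1, c) # ys) = xs"
    using assms by (subst takeWhile_append2) (auto simp: image_iff)
  then show ?thesis by (simp add: symbol_one_function_def)
qed

text \<open>
  A longer reversal brings the symbols after \<open>1\<close> to the front, so that \<open>i - 1 - length xs\<close> of
  them precede it.
\<close>

lemma symbol_one_function_prefix_shift:
  assumes "1 \<notin> fst ` set xs" "1 \<notin> fst ` set ys" "i \<le> length xs + length ys + 1"
  shows "symbol_one_function g \<chi> (prefix_shift m d i (xs @ (1, c) # ys)) =
    (if i \<le> length xs then g (length xs) * \<chi> c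
     else g (i - 1 - length xs) * \<chi> ((c + d) mod int m))"
proof (cases "i \<le> length xs")
  case True
  then have "prefix_shift m d i (xs @ (1, c) # ys) =
      (rev (map (shift_color m d) (take i xs)) @ drop i xs) @ (1, c) # ys"
    by (simp add: prefix_shift_def)
  moreover have "1 \<notin> fst ` set (rev (map (shift_color m d) (take i xs)) @ drop i xs)"
    using assms(1) by (simp add: image_Un image_image del: One_nat_def)
      (blast dest: in_set_takeD in_set_dropD)
  ultimately show ?thesis
    using True by (simp add: symbol_one_function_append del: append_assoc One_nat_def)
next
  case False
  define j where "j = i - 1 - length xs"
  have i: "i = length xs + Suc j" "j \<le> length ys"
    using False assms(3) by (auto simp: j_def)
  have "prefix_shift m d i (xs @ (1, c) # ys) =
      rev (map (shift_color m d) (take j ys)) @ (1, (c + d) mod int m) #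
        (rev (map (shift_color m d) xs) @ drop j ys)"
    by (simp add: prefix_shift_def i(1)) (simp add: shift_color_def)
  moreover have "1 \<notin> fst ` set (rev (map (shift_color m d) (take j ys)))"
    using assms(2) by (simp add: image_image del: One_nat_def) (blast dest: in_set_takeD)
  ultimately show ?thesis
    using False i by (simp add: symbol_one_function_append del: One_nat_def)
qed

lemma colored_perms_split_at_one:
  assumes "v \<in> colored_perms m n" "n \<ge> 1"
  obtains xs c ys where "v = xs @ (1, c) # ys" "1 \<notin> fst ` set xs" "1 \<notin> fst ` set ys"
    "0 \<le> c" "c < int m" "length xs + length ys + 1 = n"
proof -
  have "1 \<in> set (map fst v)" and dist: "distinct (map fst v)"
    using assms by (auto simp: colored_perms_def permutations_of_set_def)
  then obtain c where "(1, c) \<in> set v" by auto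
  then obtain xs ys where xs: "v = xs @ (1, c) # ys" by (meson split_list)
  moreover have "0 \<le> c" "c < int m" using assms(1) xs by (auto simp: colored_perms_def)
  ultimately show ?thesis
    using that[of xs c ys] dist length_colored_perms[OF assms(1)] by auto
qed

lemma colored_perms_with_one_at:
  assumes "p < n" "m > 0"
  obtains v where "v \<in> colored_perms m n" "\<And>g \<chi>. symbol_one_function g \<chi> v = g p * \<chi> 0"
proof -
  define uncolored :: "nat list \<Rightarrow> colored_word" where "uncolored = map (\<lambda>a. (a, 0))"
  define v where "v = uncolored [2..<p + 2] @ (1, 0) # uncolored [p + 2..<n + 1]"
  have "v \<in> colored_perms m n"
    using assms by (auto simp: v_def uncolored_def colored_perms_def permutations_of_set_def
        image_Un image_image o_def)
  moreover have "symbol_one_function g \<chi> v = g p * \<chi> 0" for g \<chi>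
    unfolding v_def by (subst symbol_one_function_append) (auto simp: uncolored_def simp del: upt_Suc)
  ultimately show ?thesis using that by blast
qed

text \<open>
  The reversals of length at most \<open>p\<close> contribute \<open>2 * p * g p * \<chi> c\<close>. For the longer ones the
  condition on \<open>\<chi>\<close> merges flip and flop, and the new position \<open>i - 1 - p\<close> runs over all numbers
  below \<open>n - p\<close>.
\<close>

lemma prefix_reversal_graph_eigenvalueI:
  fixes g :: "nat \<Rightarrow> real" and \<chi> :: "int \<Rightarrow> real"
  assumes m: "m > 2"
    and \<chi>: "\<And>c. 0 \<le> c \<Longrightarrow> c < int m \<Longrightarrow>
      \<chi> ((c + 1) mod int m) + \<chi> ((c - 1) mod int m) = l * \<chi> c"
    and g: "\<And>p. p < n \<Longrightarrow> 2 * real p * g p + l * (\<Sum>q<n - p. g q) = \<mu> * g p"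
    and nz: "\<chi> 0 \<noteq> 0" "r < n" "g r \<noteq> 0"
  shows "\<mu> \<in> graph_spectrum (prefix_reversal_graph m n)"
proof -
  let ?G = "prefix_reversal_graph m n" and ?f = "symbol_one_function g \<chi>"
  have V: "pverts ?G = colored_perms m n" by (simp add: prefix_reversal_graph_def)
  have "(\<Sum>w | w \<in> pverts ?G \<and> (v, w) \<in> parcs ?G. ?f w) = \<mu> * ?f v"
    if v: "v \<in> colored_perms m n" for v
  proof -
    obtain xs c ys where vs: "v = xs @ (1, c) # ys" "1 \<notin> fst ` set xs" "1 \<notin> fst ` set ys"
      and c: "0 \<le> c" "c < int m" and len: "length xs + length ys + 1 = n"
      using colored_perms_split_at_one[OF v] nz(2)
      by (metis Suc_leI One_nat_def gr_implies_not_zero not_gr_zero)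
    define p where "p = length xs"
    have p: "p < n" using len by (simp add: p_def)
    have "(\<Sum>w | w \<in> pverts ?G \<and> (v, w) \<in> parcs ?G. ?f w) =
        (\<Sum>i = 1..n. ?f (prefix_shift m 1 i v) + ?f (prefix_shift m (- 1) i v))"
      by (rule sum_neighbors[OF m v])
    also have "\<dots> = (\<Sum>i = 1..n. if i \<le> p then 2 * g p * \<chi> c else g (i - 1 - p) * (l * \<chi> c))"
      using len by (intro sum.cong refl)
        (auto simp: vs(1) symbol_one_function_prefix_shift[OF vs(2,3)] \<chi>[OF c, symmetric]
          p_def distrib_left simp del: One_nat_def)
    also have "{1..n} = {1..p} \<union> {p + 1..n}" using p by auto
    also have "(\<Sum>i\<in>{1..p} \<union> {p + 1..n}. if i \<le> p then 2 * g p * \<chi> c else g (i - 1 - p) * (l * \<chi> c))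
        = (\<Sum>i = 1..p. 2 * g p * \<chi> c) + (\<Sum>i = p + 1..n. g (i - 1 - p) * (l * \<chi> c))"
      by (subst sum.union_disjoint) (auto intro!: arg_cong2[where f = "(+)"] sum.cong)
    also have "(\<Sum>i = p + 1..n. g (i - 1 - p) * (l * \<chi> c)) = (\<Sum>q<n - p. g q * (l * \<chi> c))"
      by (rule sum.reindex_bij_witness[of _ "\<lambda>q. q + p + 1" "\<lambda>i. i - 1 - p"]) auto
    also have "(\<Sum>i = 1..p. 2 * g p * \<chi> c) + (\<Sum>q<n - p. g q * (l * \<chi> c)) =
        (2 * real p * g p + l * (\<Sum>q<n - p. g q)) * \<chi> c"
      by (simp add: algebra_simps flip: sum_distrib_left sum_distrib_right)
    also have "\<dots> = \<mu> * ?f v"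
      using g[OF p] symbol_one_function_append[OF vs(2)] by (simp add: vs(1) p_def)
    finally show ?thesis .
  qed
  moreover have "\<exists>v\<in>colored_perms m n. ?f v \<noteq> 0"
  proof -
    have "m > 0" using m by simp
    from colored_perms_with_one_at[OF nz(2) this] obtain v where
      "v \<in> colored_perms m n" "?f v = g r * \<chi> 0" by metis
    then show ?thesis using nz by (intro bexI[of _ v]) simp_all
  qed
  ultimately have "\<exists>f. (\<exists>v\<in>pverts ?G. f v \<noteq> 0) \<and>
      (\<forall>v\<in>pverts ?G. (\<Sum>w | w \<in> pverts ?G \<and> (v, w) \<in> parcs ?G. f w) = \<mu> * f v)"
    unfolding V by blast
  moreover obtain vs where "distinct vs" "set vs = pverts ?G"
    using finite_distinct_list[OF finite_colored_perms] V by metis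
  ultimately show ?thesis
    by (simp only: graph_spectrum_eq spectrum_adjacency_matrix_iff)
qed


section \<open>Eigenfunctions independent of the color\<close>

text \<open>
  For \<open>2 * k > n\<close> this is \<open>1\<close> on the positions from \<open>n - k\<close> to \<open>k - 1\<close> with the balancing value
  \<open>n - 2 * k\<close> at position \<open>k\<close>; for \<open>2 * k < n\<close> it is \<open>- 1\<close> on the positions from \<open>k\<close> to
  \<open>n - k - 1\<close> with \<open>n - 2 * k\<close> added at position \<open>k\<close>. In both cases the values at the positions
  below \<open>n\<close> have sum \<open>0\<close>, except that \<open>k = n\<close> gives the constant function \<open>1\<close>.
\<close>

definition position_weight :: "nat \<Rightarrow> nat \<Rightarrow> nat \<Rightarrow> real" where
  "position_weight n k p =
     of_bool (p < k) - of_bool (p < n - k) + (real n - 2 * real k) * of_bool (p = k)"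

lemma sum_position_weight:
  assumes "k \<le> n"
  shows "(\<Sum>q<j. position_weight n k q) =
    min (real j) (real k) - min (real j) (real n - real k) + (real n - 2 * real k) * of_bool (k < j)"
proof (induction j)
  case 0
  then show ?case using assms by simp
next
  case (Suc j)
  then show ?case
    using assms by (cases "j < k"; cases "j < n - k"; cases "j = k")
      (auto simp: position_weight_def min_def of_nat_diff)
qed

text \<open>
  The partial sum over \<open>{..<n - p}\<close> is piecewise linear in \<open>p\<close> and changes its form only at
  \<open>n - k\<close> and \<open>k\<close>, like the weight itself. So the claim is a linear identity in each
  of the ranges cut out by these two numbers.
\<close>

lemma position_weight_eigen:
  assumes "k \<le> n" "p < n"
  shows "real p * position_weight n k p + (\<Sum>q<n - p. position_weight n k q)
    = real k * position_weight n k p"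
  unfolding sum_position_weight[OF assms(1)]
  using assms by (cases "p < k"; cases "p < n - k"; cases "p = k")
    (auto simp: position_weight_def min_def of_nat_diff algebra_simps)

text \<open>
  For \<open>k < n\<close> the weight at position \<open>k\<close> is \<open>n - 2 * k\<close>, diminished by \<open>1\<close> if \<open>2 * k < n\<close>. It is
  zero only for \<open>n = 2 * k\<close> and \<open>n = 2 * k + 1\<close>, that is, for \<open>k = n div 2\<close>. For \<open>k = n\<close> this
  position is out of range, but all others have weight \<open>1\<close>.
\<close>

lemma position_weight_nonzero:
  assumes "k \<le> n" "n \<ge> 1" "k \<noteq> n div 2"
  obtains p where "p < n" "position_weight n k p \<noteq> 0"
proof (cases "k = n")
  case True
  then show ?thesis using assms that[of 0] by (simp add: position_weight_def)
next
  case False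
  have "real n - 2 * real k \<noteq> of_bool (k < n - k)"
  proof
    assume "real n - 2 * real k = of_bool (k < n - k)"
    then have "n = 2 * k + of_bool (k < n - k)"
      by (cases "k < n - k") (auto simp: algebra_simps simp flip: of_nat_add of_nat_mult of_nat_Suc)
    with assms(3) show False by (cases "k < n - k") auto
  qed
  then show ?thesis using False assms(1) that[of k] by (simp add: position_weight_def)
qed

lemma even_in_spectrum:
  assumes "m > 2" "n \<ge> 1" "k \<le> n" "k \<noteq> n div 2"
  shows "2 * real k \<in> graph_spectrum (prefix_reversal_graph m n)"
proof -
  obtain p where p: "p < n" "position_weight n k p \<noteq> 0"
    using position_weight_nonzero[OF assms(3,2,4)] .
  show ?thesis
  proof (rule prefix_reversal_graph_eigenvalueI[where \<chi> = "\<lambda>_. 1" and l = 2])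
    fix p assume "p < n"
    from position_weight_eigen[OF assms(3) this]
    show "2 * real p * position_weight n k p + 2 * (\<Sum>q<n - p. position_weight n k q) =
        2 * real k * position_weight n k p" by simp
  qed (use assms(1) p in auto)
qed


section \<open>A character of order four\<close>

text \<open>The values of \<open>cos (pi * c / 2)\<close>, the real part of a character of order four.\<close>

definition quarter_cos :: "int \<Rightarrow> real" where
  "quarter_cos c = (if c mod 4 = 0 then 1 else if c mod 4 = 2 then - 1 else 0)"

lemma quarter_cos_neighbors: "quarter_cos (c + 1) + quarter_cos (c - 1) = 0"
proof -
  have "c mod 4 \<in> {0, 1, 2, 3}" by auto
  then show ?thesis
    by (auto simp: quarter_cos_def mod_add_left_eq[of c 4 1, symmetric]
        mod_diff_left_eq[of c 4 1, symmetric])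
qed

lemma quarter_cos_mod:
  assumes "4 dvd m"
  shows "quarter_cos (c mod int m) = quarter_cos c"
  using assms by (simp add: quarter_cos_def mod_mod_cancel int_dvd_int_iff[of 4 m, simplified])

text \<open>
  With \<open>l = 0\<close> the functions concentrated at a single position \<open>k\<close> solve the system.
\<close>

lemma even_less_in_spectrum_if_4_dvd:
  assumes "m > 2" "4 dvd m" "k < n"
  shows "2 * real k \<in> graph_spectrum (prefix_reversal_graph m n)"
proof (rule prefix_reversal_graph_eigenvalueI[where \<chi> = quarter_cos and l = 0 and r = k
      and g = "\<lambda>p. of_bool (p = k)"])
  show "quarter_cos ((c + 1) mod int m) + quarter_cos ((c - 1) mod int m) = 0 * quarter_cos c" for c
    using quarter_cos_neighbors[of c] by (simp add: quarter_cos_mod[OF assms(2)])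
qed (use assms in \<open>auto simp: quarter_cos_def\<close>)


section \<open>Even integers in the spectrum\<close>

theorem theorem4p1:
  fixes m n :: nat
  assumes "m > 2" and "n \<ge> 1"
  shows "(\<forall>k::int. k \<in> {0..2 * int n} - {2 * \<lfloor>real n / 2\<rfloor>} \<and> even k \<longrightarrow>
            of_int k \<in> graph_spectrum (prefix_reversal_graph m n)) \<and>
         ([m = 0] (mod 4) \<longrightarrow>
           (\<forall>k::int. k \<in> {0..2 * int n} \<and> even k \<longrightarrow>
              of_int k \<in> graph_spectrum (prefix_reversal_graph m n)))"
proof -
  have floor_half: "\<lfloor>real n / 2\<rfloor> = int (n div 2)"
    using floor_divide_of_nat_eq[of n 2, where 'a = real] by simp
  have half: "\<exists>j. k = 2 * int j \<and> j \<le> n" if "k \<in> {0..2 * int n}" "even k" for k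
    using that by (intro exI[of _ "nat (k div 2)"]) auto
  have "of_int k \<in> graph_spectrum (prefix_reversal_graph m n)"
    if k: "k \<in> {0..2 * int n}" "even k" and "k \<noteq> 2 * \<lfloor>real n / 2\<rfloor> \<or> [m = 0] (mod 4)" for k
  proof -
    obtain j where j: "k = 2 * int j" "j \<le> n" using half[OF k] by blast
    have "2 * real j \<in> graph_spectrum (prefix_reversal_graph m n)"
    proof (cases "j = n div 2")
      case True
      then have "4 dvd m" "j < n"
        using that(3) j(1) assms(2) by (auto simp: floor_half cong_0_iff)
      then show ?thesis using even_less_in_spectrum_if_4_dvd assms(1) by blast
    qed (use even_in_spectrum assms j in blast)
    then show ?thesis using j(1) by simp
  qed
  then show ?thesis by blast
qed

end
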